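(* In the category $\mathcal{P}_\Sigma=\square_S^{op}\mathrm{Set}\downarrow\,!^S\Sigma$, the codiagonal $(!^S\Sigma/\!/\Sigma)\sqcup(!^S\Sigma/\!/\Sigma)\to(!^S\Sigma/\!/\Sigma)$ factors as a composite $$(!^S\Sigma/\!/\Sigma)\sqcup(!^S\Sigma/\!/\Sigma)\longrightarrow(!^S(\Sigma\times\{0,1\})/\!/\Sigma)\longrightarrow(!^S\Sigma/\!/\Sigma)$$ such that the left-hand map induces a cofibration $(K/\!/\Sigma)\sqcup(K/\!/\Sigma)\to\mathrm{Cyl}(K/\!/\Sigma)$ for any labelled symmetric precubical set $(K/\!/\Sigma)$. In other terms, the interval object $(!^S(\Sigma\times\{0,1\})/\!/\Sigma)$ is good.
   Context: Fix a nonempty set $\Sigma$ of labels. Let $[n]=\{0,1\}^n$. Let $\square_S$ be the subcategory of $\mathrm{Set}$ with objects $[n]$, $n\ge 0$, generated by the face maps $\delta_i^\alpha:[n-1]\to[n]$ inserting $\alpha\in\{0,1\}$ at position $i$, and the symmetry maps $\sigma_i:[n]\to[n]$ swapping coordinates $i$ and $i+1$. A symmetric precubical set is a presheaf $K$ on $\square_S$; $K_n:=K([n])$. For a set $A$, $!^SA$ has $(!^SA)_n=A^n$, both $i$-th face operators deleting the $i$-th letter and the symmetry operators exchanging adjacent letters. A labelled symmetric precubical set $(K/\!/\Sigma)$ is an object $K\to\,!^S\Sigma$ of the slice category $\mathcal P_\Sigma$. The terminal object is $\mathbf 1=(!^S\Sigma/\!/\Sigma)$. The interval object $(!^S(\Sigma\times\{0,1\})/\!/\Sigma)$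 is induced by the projection $\Sigma\times\{0,1\}\to\Sigma$, with the maps $\gamma^k:\mathbf 1\to(!^S(\Sigma\times\{0,1\})/\!/\Sigma)$ ($k=0,1$) induced by $\Sigma\cong\Sigma\times\{k\}\subset\Sigma\times\{0,1\}$ and $\sigma:(!^S(\Sigma\times\{0,1\})/\!/\Sigma)\to\mathbf 1$ induced by the projection; $\mathrm{Cyl}(K/\!/\Sigma)=(!^S(\Sigma\times\{0,1\})/\!/\Sigma)\times(K/\!/\Sigma)$ (product in $\mathcal P_\Sigma$). A cofibration is a map $(K/\!/\Sigma)\to(L/\!/\Sigma)$ such that $K_n\to L_n$ is injective for every $n\ge1$. The interval object is good when, for every $X$, the codiagonal of $X$ factors as $X\sqcup X\xrightarrow{\gamma^0_X\sqcup\gamma^1_X}\mathrm{Cyl}(X)\xrightarrow{\sigma_X}X$ with $\gamma^0_X\sqcup\gamma^1_X$ a cofibration. *)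

theory Defs
  imports "HOL-Library.FuncSet"
begin

text \<open>
  Maps between sets are represented throughout by extensional functions (with value
  \<^const>\<open>undefined\<close> off the domain), so that equality of maps is equality in HOL, and they are
  composed with \<^const>\<open>compose\<close>.  Positions in words are counted from 0.
\<close>

definition cube :: "nat \<Rightarrow> bool list set" where
  "cube n = {x. length x = n}"

definition face :: "nat \<Rightarrow> nat \<Rightarrow> bool \<Rightarrow> bool list \<Rightarrow> bool list" where
  "face n i \<alpha> = (\<lambda>x\<in>cube n. take i x @ \<alpha> # drop i x)"

definition swap_adj :: "nat \<Rightarrow> 'a list \<Rightarrow> 'a list" where
  "swap_adj i x = x[i := x ! Suc i, Suc i := x ! i]"

definition symm :: "nat \<Rightarrow> nat \<Rightarrow> bool list \<Rightarrow> bool list" where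
  "symm n i = (\<lambda>x\<in>cube n. swap_adj i x)"

text \<open>\<open>box m n f\<close>: the map \<open>f : [m] \<rightarrow> [n]\<close> belongs to the subcategory of sets generated by
  the face maps and the symmetry maps.\<close>

inductive box :: "nat \<Rightarrow> nat \<Rightarrow> (bool list \<Rightarrow> bool list) \<Rightarrow> bool" where
  box_id: "box n n (\<lambda>x\<in>cube n. x)"
| box_face: "i \<le> n \<Longrightarrow> box n (Suc n) (face n i \<alpha>)"
| box_symm: "Suc i < n \<Longrightarrow> box n n (symm n i)"
| box_comp: "box l m f \<Longrightarrow> box m n g \<Longrightarrow> box l n (compose (cube l) g f)"

text \<open>\<open>act K m n f : K\<^sub>n \<rightarrow> K\<^sub>m\<close> is the value of the presheaf \<open>K\<close> at \<open>f : [m] \<rightarrow> [n]\<close>.\<close>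

record 'a presheaf =
  obj :: "nat \<Rightarrow> 'a set"
  act :: "nat \<Rightarrow> nat \<Rightarrow> (bool list \<Rightarrow> bool list) \<Rightarrow> 'a \<Rightarrow> 'a"

definition symmetric_precubical_set :: "'a presheaf \<Rightarrow> bool" where
  "symmetric_precubical_set K \<longleftrightarrow>
     (\<forall>m n f. box m n f \<longrightarrow> act K m n f \<in> obj K n \<rightarrow>\<^sub>E obj K m) \<and>
     (\<forall>n. act K n n (\<lambda>x\<in>cube n. x) = (\<lambda>x\<in>obj K n. x)) \<and>
     (\<forall>l m n f g. box l m f \<longrightarrow> box m n g \<longrightarrow>
        act K l n (compose (cube l) g f) = compose (obj K n) (act K l m f) (act K m n g))"

definition presheaf_hom :: "'a presheaf \<Rightarrow> 'b presheaf \<Rightarrow> (nat \<Rightarrow> 'a \<Rightarrow> 'b) set" where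
  "presheaf_hom K L = {\<phi>. (\<forall>n. \<phi> n \<in> obj K n \<rightarrow>\<^sub>E obj L n) \<and>
     (\<forall>m n f. box m n f \<longrightarrow>
        compose (obj K n) (\<phi> m) (act K m n f) = compose (obj K n) (act L m n f) (\<phi> n))}"

text \<open>
  In a morphism \<open>f : [m] \<rightarrow> [n]\<close> of the category of cubes every input coordinate \<open>j < m\<close> is copied
  to exactly one output coordinate \<open>slot m n f j\<close> (lemma \<open>box_slot\<close> below), the other output
  coordinates being constant.  The induced map \<open>A\<^sup>n \<rightarrow> A\<^sup>m\<close> reads the letters at these positions.
  Lemmas \<open>bangS_face\<close> and \<open>bangS_symm\<close> show that this is the presheaf whose face operators delete
  a letter and whose symmetry operators exchange adjacent letters.
\<close>

definition slot :: "nat \<Rightarrow> nat \<Rightarrow> (bool list \<Rightarrow> bool list) \<Rightarrow> nat \<Rightarrow> nat" where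
  "slot m n f j = (THE i. i < n \<and> (\<forall>x\<in>cube m. f x ! i = x ! j))"

definition words :: "'l set \<Rightarrow> nat \<Rightarrow> 'l list set" where
  "words A n = {w. length w = n \<and> set w \<subseteq> A}"

definition bangS :: "'l set \<Rightarrow> 'l list presheaf" where
  "bangS A = \<lparr> obj = words A,
     act = (\<lambda>m n f. \<lambda>w\<in>words A n. map (\<lambda>j. w ! slot m n f j) [0..<m]) \<rparr>"

definition bangS_map :: "'l set \<Rightarrow> ('l \<Rightarrow> 'k) \<Rightarrow> nat \<Rightarrow> 'l list \<Rightarrow> 'k list" where
  "bangS_map A h n = (\<lambda>w\<in>words A n. map h w)"

record ('a, 'l) labelled =
  tot :: "'a presheaf"
  lab :: "nat \<Rightarrow> 'a \<Rightarrow> 'l list"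

abbreviation cells :: "('a, 'l) labelled \<Rightarrow> nat \<Rightarrow> 'a set" where
  "cells X \<equiv> obj (tot X)"

definition P_obj :: "'l set \<Rightarrow> ('a, 'l) labelled \<Rightarrow> bool" where
  "P_obj \<Sigma> X \<longleftrightarrow>
     symmetric_precubical_set (tot X) \<and> lab X \<in> presheaf_hom (tot X) (bangS \<Sigma>)"

definition comp_map ::
  "('a, 'l) labelled \<Rightarrow> (nat \<Rightarrow> 'b \<Rightarrow> 'c) \<Rightarrow> (nat \<Rightarrow> 'a \<Rightarrow> 'b) \<Rightarrow> nat \<Rightarrow> 'a \<Rightarrow> 'c" where
  "comp_map X \<psi> \<phi> n = compose (cells X n) (\<psi> n) (\<phi> n)"

definition id_map :: "('a, 'l) labelled \<Rightarrow> nat \<Rightarrow> 'a \<Rightarrow> 'a" where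
  "id_map X n = (\<lambda>x\<in>cells X n. x)"

definition P_hom ::
  "'l set \<Rightarrow> ('a, 'l) labelled \<Rightarrow> ('b, 'l) labelled \<Rightarrow> (nat \<Rightarrow> 'a \<Rightarrow> 'b) \<Rightarrow> bool" where
  "P_hom \<Sigma> X Y \<phi> \<longleftrightarrow> P_obj \<Sigma> X \<and> P_obj \<Sigma> Y \<and>
     \<phi> \<in> presheaf_hom (tot X) (tot Y) \<and> comp_map X (lab Y) \<phi> = lab X"

definition cofibration ::
  "'l set \<Rightarrow> ('a, 'l) labelled \<Rightarrow> ('b, 'l) labelled \<Rightarrow> (nat \<Rightarrow> 'a \<Rightarrow> 'b) \<Rightarrow> bool" where
  "cofibration \<Sigma> X Y \<phi> \<longleftrightarrow> P_hom \<Sigma> X Y \<phi> \<and> (\<forall>n\<ge>1. inj_on (\<phi> n) (cells X n))"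

definition terminal :: "'l set \<Rightarrow> ('l list, 'l) labelled" where
  "terminal \<Sigma> = \<lparr> tot = bangS \<Sigma>, lab = (\<lambda>n. \<lambda>w\<in>words \<Sigma> n. w) \<rparr>"

definition coprod ::
  "('a, 'l) labelled \<Rightarrow> ('b, 'l) labelled \<Rightarrow> ('a + 'b, 'l) labelled" where
  "coprod X Y = \<lparr>
     tot = \<lparr> obj = (\<lambda>n. cells X n <+> cells Y n),
             act = (\<lambda>m n f. \<lambda>z\<in>cells X n <+> cells Y n.
                      map_sum (act (tot X) m n f) (act (tot Y) m n f) z) \<rparr>,
     lab = (\<lambda>n. \<lambda>z\<in>cells X n <+> cells Y n. case_sum (lab X n) (lab Y n) z) \<rparr>"

definition in_left :: "('a, 'l) labelled \<Rightarrow> nat \<Rightarrow> 'a \<Rightarrow> 'a + 'b" where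
  "in_left X n = (\<lambda>x\<in>cells X n. Inl x)"

definition in_right :: "('b, 'l) labelled \<Rightarrow> nat \<Rightarrow> 'b \<Rightarrow> 'a + 'b" where
  "in_right Y n = (\<lambda>y\<in>cells Y n. Inr y)"

definition copair :: "('a, 'l) labelled \<Rightarrow> ('b, 'l) labelled \<Rightarrow>
    (nat \<Rightarrow> 'a \<Rightarrow> 'c) \<Rightarrow> (nat \<Rightarrow> 'b \<Rightarrow> 'c) \<Rightarrow> nat \<Rightarrow> 'a + 'b \<Rightarrow> 'c" where
  "copair X Y \<phi> \<psi> n = (\<lambda>z\<in>cells X n <+> cells Y n. case_sum (\<phi> n) (\<psi> n) z)"

definition codiagonal :: "('a, 'l) labelled \<Rightarrow> nat \<Rightarrow> 'a + 'a \<Rightarrow> 'a" where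
  "codiagonal X = copair X X (id_map X) (id_map X)"

text \<open>The product in the slice category is the fibre product over the base.\<close>

definition fprod ::
  "('a, 'l) labelled \<Rightarrow> ('b, 'l) labelled \<Rightarrow> ('a \<times> 'b, 'l) labelled" where
  "fprod X Y = (let P = (\<lambda>n. {(x, y). x \<in> cells X n \<and> y \<in> cells Y n \<and> lab X n x = lab Y n y}) in \<lparr>
     tot = \<lparr> obj = P,
             act = (\<lambda>m n f. \<lambda>z\<in>P n.
                      map_prod (act (tot X) m n f) (act (tot Y) m n f) z) \<rparr>,
     lab = (\<lambda>n. \<lambda>z\<in>P n. lab X n (fst z)) \<rparr>)"

definition proj_left ::
  "('a, 'l) labelled \<Rightarrow> ('b, 'l) labelled \<Rightarrow> nat \<Rightarrow> 'a \<times> 'b \<Rightarrow> 'a" where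
  "proj_left X Y n = (\<lambda>z\<in>cells (fprod X Y) n. fst z)"

definition proj_right ::
  "('a, 'l) labelled \<Rightarrow> ('b, 'l) labelled \<Rightarrow> nat \<Rightarrow> 'a \<times> 'b \<Rightarrow> 'b" where
  "proj_right X Y n = (\<lambda>z\<in>cells (fprod X Y) n. snd z)"

definition pairing ::
  "('c, 'l) labelled \<Rightarrow> (nat \<Rightarrow> 'c \<Rightarrow> 'a) \<Rightarrow> (nat \<Rightarrow> 'c \<Rightarrow> 'b) \<Rightarrow> nat \<Rightarrow> 'c \<Rightarrow> 'a \<times> 'b" where
  "pairing Z \<phi> \<psi> n = (\<lambda>z\<in>cells Z n. (\<phi> n z, \<psi> n z))"

definition prod_map :: "('a, 'l) labelled \<Rightarrow> ('b, 'l) labelled \<Rightarrow>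
    (nat \<Rightarrow> 'a \<Rightarrow> 'c) \<Rightarrow> (nat \<Rightarrow> 'b \<Rightarrow> 'd) \<Rightarrow> nat \<Rightarrow> 'a \<times> 'b \<Rightarrow> 'c \<times> 'd" where
  "prod_map X Y \<phi> \<psi> = pairing (fprod X Y)
     (comp_map (fprod X Y) \<phi> (proj_left X Y)) (comp_map (fprod X Y) \<psi> (proj_right X Y))"

text \<open>The set \<open>{0,1}\<close> is \<^typ>\<open>bool\<close>, with \<^const>\<open>False\<close> for 0 and \<^const>\<open>True\<close> for 1.\<close>

definition interval :: "'l set \<Rightarrow> (('l \<times> bool) list, 'l) labelled" where
  "interval \<Sigma> = \<lparr> tot = bangS (\<Sigma> \<times> UNIV), lab = bangS_map (\<Sigma> \<times> UNIV) fst \<rparr>"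

definition \<gamma> :: "'l set \<Rightarrow> bool \<Rightarrow> nat \<Rightarrow> 'l list \<Rightarrow> ('l \<times> bool) list" where
  "\<gamma> \<Sigma> k = bangS_map \<Sigma> (\<lambda>a. (a, k))"

definition \<sigma> :: "'l set \<Rightarrow> nat \<Rightarrow> ('l \<times> bool) list \<Rightarrow> 'l list" where
  "\<sigma> \<Sigma> = bangS_map (\<Sigma> \<times> UNIV) fst"

definition \<gamma>_sum :: "'l set \<Rightarrow> nat \<Rightarrow> 'l list + 'l list \<Rightarrow> ('l \<times> bool) list" where
  "\<gamma>_sum \<Sigma> = copair (terminal \<Sigma>) (terminal \<Sigma>) (\<gamma> \<Sigma> False) (\<gamma> \<Sigma> True)"

definition Cyl ::
  "'l set \<Rightarrow> ('a, 'l) labelled \<Rightarrow> (('l \<times> bool) list \<times> 'a, 'l) labelled" where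
  "Cyl \<Sigma> X = fprod (interval \<Sigma>) X"

text \<open>\<open>\<gamma>\<^sup>k\<^sub>X\<close> is \<open>X \<cong> \<one> \<times> X \<rightarrow> Cyl X\<close>, with \<open>\<gamma>\<^sup>k \<times> id\<close> as second map, and \<open>\<sigma>\<^sub>X\<close> is \<open>Cyl X \<rightarrow> \<one> \<times> X \<cong> X\<close>,
  with \<open>\<sigma> \<times> id\<close> as first map.  The map \<open>X \<rightarrow> \<one>\<close> is the labelling \<open>lab X\<close> itself.\<close>

definition \<gamma>_cyl :: "'l set \<Rightarrow> ('a, 'l) labelled \<Rightarrow> bool \<Rightarrow>
    nat \<Rightarrow> 'a \<Rightarrow> ('l \<times> bool) list \<times> 'a" where
  "\<gamma>_cyl \<Sigma> X k =
     comp_map X (prod_map (terminal \<Sigma>) X (\<gamma> \<Sigma> k) (id_map X)) (pairing X (lab X) (id_map X))"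

definition \<sigma>_cyl :: "'l set \<Rightarrow> ('a, 'l) labelled \<Rightarrow>
    nat \<Rightarrow> ('l \<times> bool) list \<times> 'a \<Rightarrow> 'a" where
  "\<sigma>_cyl \<Sigma> X = comp_map (Cyl \<Sigma> X) (proj_right (terminal \<Sigma>) X)
     (prod_map (interval \<Sigma>) X (\<sigma> \<Sigma>) (id_map X))"

definition \<gamma>_cyl_sum :: "'l set \<Rightarrow> ('a, 'l) labelled \<Rightarrow>
    nat \<Rightarrow> 'a + 'a \<Rightarrow> ('l \<times> bool) list \<times> 'a" where
  "\<gamma>_cyl_sum \<Sigma> X = copair X X (\<gamma>_cyl \<Sigma> X False) (\<gamma>_cyl \<Sigma> X True)"

text \<open>The map \<open>X \<squnion> X \<cong> (\<one> \<squnion> \<one>) \<times> X \<rightarrow> Cyl X\<close> induced by \<open>\<phi> : \<one> \<squnion> \<one> \<rightarrow> interval\<close>,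
  with \<open>\<phi> \<times> id\<close> as second map.\<close>

definition two_copies :: "'l set \<Rightarrow> ('a, 'l) labelled \<Rightarrow>
    nat \<Rightarrow> 'a + 'a \<Rightarrow> ('l list + 'l list) \<times> 'a" where
  "two_copies \<Sigma> X = copair X X
     (pairing X (comp_map X (in_left (terminal \<Sigma>)) (lab X)) (id_map X))
     (pairing X (comp_map X (in_right (terminal \<Sigma>)) (lab X)) (id_map X))"

definition induced :: "'l set \<Rightarrow> ('a, 'l) labelled \<Rightarrow>
    (nat \<Rightarrow> 'l list + 'l list \<Rightarrow> ('l \<times> bool) list) \<Rightarrow>
    nat \<Rightarrow> 'a + 'a \<Rightarrow> ('l \<times> bool) list \<times> 'a" where
  "induced \<Sigma> X \<phi> = comp_map (coprod X X)
     (prod_map (coprod (terminal \<Sigma>) (terminal \<Sigma>)) X \<phi> (id_map X)) (two_copies \<Sigma> X)"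

text \<open>The type argument fixes the type from which the cells of the objects \<open>X\<close> are drawn;
  a theorem about \<open>good_interval \<Sigma> TYPE('a)\<close> holds for every type \<open>'a\<close>.\<close>

definition good_interval :: "'l set \<Rightarrow> 'a itself \<Rightarrow> bool" where
  "good_interval \<Sigma> _ \<longleftrightarrow> (\<forall>X :: ('a, 'l) labelled. P_obj \<Sigma> X \<longrightarrow>
     cofibration \<Sigma> (coprod X X) (Cyl \<Sigma> X) (\<gamma>_cyl_sum \<Sigma> X) \<and>
     P_hom \<Sigma> (Cyl \<Sigma> X) X (\<sigma>_cyl \<Sigma> X) \<and>
     comp_map (coprod X X) (\<sigma>_cyl \<Sigma> X) (\<gamma>_cyl_sum \<Sigma> X) = codiagonal X)"

lemma swap_adj_length [simp]: "length (swap_adj i x) = length x"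
  by (simp add: swap_adj_def)

lemma swap_adj_nth:
  assumes "Suc i < length x" "k < length x"
  shows "swap_adj i x ! k = x ! (if k = i then Suc i else if k = Suc i then i else k)"
  using assms by (auto simp: swap_adj_def nth_list_update)

lemma face_nth:
  assumes "x \<in> cube n" "i \<le> n" "k \<le> n"
  shows "face n i \<alpha> x ! k = (if k < i then x ! k else if k = i then \<alpha> else x ! (k - 1))"
  using assms by (auto simp: face_def cube_def nth_append min_def nth_Cons')

lemma symm_nth:
  assumes "x \<in> cube n" "Suc i < n" "k < n"
  shows "symm n i x ! k = x ! (if k = i then Suc i else if k = Suc i then i else k)"
  using assms swap_adj_nth[of i x k] by (simp add: symm_def cube_def)

lemma box_funcset: "box m n f \<Longrightarrow> f \<in> cube m \<rightarrow>\<^sub>E cube n"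
proof (induction rule: box.induct)
  case (box_comp l m f n g)
  then show ?case by (auto simp: compose_def PiE_iff extensional_def)
qed (auto simp: cube_def face_def symm_def PiE_iff extensional_def)

lemma nth_separates:
  assumes "j < m" "k < m" "\<forall>x\<in>cube m. x ! j = x ! k"
  shows "j = k"
proof (rule ccontr)
  assume "j \<noteq> k"
  have "(replicate m False)[j := True] \<in> cube m" by (simp add: cube_def)
  with assms \<open>j \<noteq> k\<close> show False by fastforce
qed

lemma nth_nonconst:
  assumes "j < m"
  shows "\<not> (\<forall>x\<in>cube m. x ! j = c)"
proof
  assume *: "\<forall>x\<in>cube m. x ! j = c"
  have "replicate m (\<not> c) \<in> cube m" by (simp add: cube_def)
  with * assms show False by force
qed

lemma box_shape:
  "box m n f \<Longrightarrow> \<exists>p. (\<forall>j<m. p j < n \<and> (\<forall>x\<in>cube m. f x ! p j = x ! j)) \<and>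
     (\<forall>i<n. i \<in> p ` {..<m} \<or> (\<exists>c. \<forall>x\<in>cube m. f x ! i = c))"
proof (induction rule: box.induct)
  case (box_id n)
  show ?case by (rule exI[of _ "\<lambda>j. j"]) auto
next
  case (box_face i n \<alpha>)
  let ?p = "\<lambda>j. if j < i then j else Suc j"
  have "k \<in> ?p ` {..<n} \<or> (\<exists>c. \<forall>x\<in>cube n. face n i \<alpha> x ! k = c)" if "k < Suc n" for k
  proof (cases "k = i")
    case True
    then show ?thesis using box_face by (auto simp: face_nth)
  next
    case False
    then have "k = ?p (if k < i then k else k - 1)" "(if k < i then k else k - 1) < n"
      using that box_face by auto
    then show ?thesis by blast
  qed
  then show ?case using box_face by (intro exI[of _ ?p]) (auto simp: face_nth)
next
  case (box_symm i n)
  let ?p = "\<lambda>j. if j = i then Suc i else if j = Suc i then i else j"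
  have "k \<in> ?p ` {..<n}" if "k < n" for k
    by (rule image_eqI[of _ _ "?p k"]) (use that box_symm in auto)
  then show ?case using box_symm by (intro exI[of _ ?p]) (auto simp: symm_nth)
next
  case (box_comp l m f n g)
  then obtain p q where p: "\<forall>j<l. p j < m \<and> (\<forall>x\<in>cube l. f x ! p j = x ! j)"
      "\<forall>i<m. i \<in> p ` {..<l} \<or> (\<exists>c. \<forall>x\<in>cube l. f x ! i = c)"
    and q: "\<forall>j<m. q j < n \<and> (\<forall>x\<in>cube m. g x ! q j = x ! j)"
      "\<forall>i<n. i \<in> q ` {..<m} \<or> (\<exists>c. \<forall>x\<in>cube m. g x ! i = c)" by blast
  have f: "f x \<in> cube m" if "x \<in> cube l" for x
    using box_funcset[OF box_comp.hyps(1)] that by blast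
  have "k \<in> (q \<circ> p) ` {..<l} \<or> (\<exists>c. \<forall>x\<in>cube l. compose (cube l) g f x ! k = c)" if k: "k < n" for k
  proof (cases "k \<in> q ` {..<m}")
    case True
    then obtain i where i: "i < m" "k = q i" by blast
    show ?thesis
    proof (cases "i \<in> p ` {..<l}")
      case True
      then obtain j where "j \<in> {..<l}" "k = (q \<circ> p) j" using i(2) by auto
      then have "k \<in> (q \<circ> p) ` {..<l}" by (rule image_eqI[rotated])
      then show ?thesis by (rule disjI1)
    next
      case False
      then obtain c where "\<forall>x\<in>cube l. f x ! i = c" using p(2) i(1) by metis
      then have "\<forall>x\<in>cube l. compose (cube l) g f x ! k = c" using q(1) i f by (simp add: compose_eq)
      then show ?thesis by blast
    qed
  next
    case False
    then obtain c where "\<forall>x\<in>cube m. g x ! k = c" using q(2) k by metis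
    then have "\<forall>x\<in>cube l. compose (cube l) g f x ! k = c" using f by (simp add: compose_eq)
    then show ?thesis by blast
  qed
  moreover have "\<forall>j<l. (q \<circ> p) j < n \<and> (\<forall>x\<in>cube l. compose (cube l) g f x ! (q \<circ> p) j = x ! j)"
    using p(1) q(1) f by (simp add: compose_eq)
  ultimately show ?case by blast
qed

lemma box_slot_unique:
  assumes "box m n f" "j < m"
  shows "\<exists>!i. i < n \<and> (\<forall>x\<in>cube m. f x ! i = x ! j)"
proof -
  obtain p where p: "\<forall>j<m. p j < n \<and> (\<forall>x\<in>cube m. f x ! p j = x ! j)"
      "\<forall>i<n. i \<in> p ` {..<m} \<or> (\<exists>c. \<forall>x\<in>cube m. f x ! i = c)"
    using box_shape[OF assms(1)] by blast
  show ?thesis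
  proof (rule ex1I[of _ "p j"])
    show "p j < n \<and> (\<forall>x\<in>cube m. f x ! p j = x ! j)" using p assms by blast
    fix i assume i: "i < n \<and> (\<forall>x\<in>cube m. f x ! i = x ! j)"
    then have "\<not> (\<exists>c. \<forall>x\<in>cube m. f x ! i = c)" using nth_nonconst[OF assms(2)] by auto
    then obtain j' where j': "j' < m" "i = p j'" using p i by blast
    then have "\<forall>x\<in>cube m. x ! j = x ! j'" using i p by metis
    then show "i = p j" using nth_separates assms(2) j' by blast
  qed
qed

lemma box_slot:
  assumes "box m n f" "j < m"
  shows "slot m n f j < n" and "x \<in> cube m \<Longrightarrow> f x ! slot m n f j = x ! j"
  using theI'[OF box_slot_unique[OF assms]] unfolding slot_def by auto

lemma slot_eqI:
  assumes "box m n f" "j < m" "i < n" "\<And>x. x \<in> cube m \<Longrightarrow> f x ! i = x ! j"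
  shows "slot m n f j = i"
  unfolding slot_def using the1_equality[OF box_slot_unique[OF assms(1,2)]] assms by blast

lemma slot_id: "j < n \<Longrightarrow> slot n n (\<lambda>x\<in>cube n. x) j = j"
  by (rule slot_eqI[OF box_id]) auto

lemma slot_comp:
  assumes "box l m f" "box m n g" "j < l"
  shows "slot l n (compose (cube l) g f) j = slot m n g (slot l m f j)"
proof (rule slot_eqI[OF box_comp[OF assms(1,2)] assms(3)])
  note b = box_slot[OF assms(1,3)]
  show "slot m n g (slot l m f j) < n" by (rule box_slot(1)[OF assms(2) b(1)])
  fix x assume x: "x \<in> cube l"
  then have "f x \<in> cube m" using box_funcset[OF assms(1)] by blast
  then show "compose (cube l) g f x ! slot m n g (slot l m f j) = x ! j"
    using x box_slot(2)[OF assms(2) b(1)] b(2) by (simp add: compose_eq)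
qed

lemma bangS_obj [simp]: "obj (bangS A) = words A"
  by (simp add: bangS_def)

lemma bangS_act:
  "act (bangS A) m n f = (\<lambda>w\<in>words A n. map (\<lambda>j. w ! slot m n f j) [0..<m])"
  by (simp add: bangS_def)

lemma bangS_face:
  assumes "i \<le> n" "w \<in> words A (Suc n)"
  shows "act (bangS A) n (Suc n) (face n i \<alpha>) w = take i w @ drop (Suc i) w"
proof -
  have s: "slot n (Suc n) (face n i \<alpha>) j = (if j < i then j else Suc j)" if "j < n" for j
    by (rule slot_eqI[OF box_face[OF assms(1)] that]) (use that assms in \<open>auto simp: face_nth\<close>)
  show ?thesis
    by (rule nth_equalityI) (use assms in \<open>auto simp: bangS_act s words_def nth_append min_def\<close>)
qed

lemma bangS_symm:
  assumes "Suc i < n" "w \<in> words A n"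
  shows "act (bangS A) n n (symm n i) w = swap_adj i w"
proof -
  have s: "slot n n (symm n i) j = (if j = i then Suc i else if j = Suc i then i else j)"
    if "j < n" for j
    by (rule slot_eqI[OF box_symm[OF assms(1)] that]) (use that assms in \<open>auto simp: symm_nth\<close>)
  show ?thesis
    by (rule nth_equalityI) (use assms in \<open>auto simp: bangS_act s words_def swap_adj_nth\<close>)
qed

lemma bangS_presheaf: "symmetric_precubical_set (bangS A)"
  unfolding symmetric_precubical_set_def
proof (intro conjI allI impI)
  show act: "act (bangS A) m n f \<in> obj (bangS A) n \<rightarrow>\<^sub>E obj (bangS A) m" if "box m n f" for m n f
    using box_slot(1)[OF that] by (fastforce simp: bangS_act words_def)
  show "act (bangS A) n n (\<lambda>x\<in>cube n. x) = (\<lambda>x\<in>obj (bangS A) n. x)" for n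
    unfolding bangS_act bangS_obj
    by (rule restrict_ext) (auto simp: words_def slot_id intro!: nth_equalityI)
  show "act (bangS A) l n (compose (cube l) g f)
      = compose (obj (bangS A) n) (act (bangS A) l m f) (act (bangS A) m n g)"
    if "box l m f" "box m n g" for l m n f g
  proof (rule ext)
    fix w
    show "act (bangS A) l n (compose (cube l) g f) w
      = compose (obj (bangS A) n) (act (bangS A) l m f) (act (bangS A) m n g) w"
    proof (cases "w \<in> words A n")
      case True
      then have "act (bangS A) m n g w \<in> words A m" using act[OF that(2)] by auto
      then show ?thesis using True slot_comp[OF that] box_slot(1)[OF that(1)]
        by (auto simp: compose_def bangS_act)
    qed (simp add: compose_def bangS_act)
  qed
qed

lemma presheaf_homI:
  assumes "\<And>n. \<phi> n \<in> obj K n \<rightarrow>\<^sub>E obj L n"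
    and "\<And>m n f x. box m n f \<Longrightarrow> x \<in> obj K n \<Longrightarrow> \<phi> m (act K m n f x) = act L m n f (\<phi> n x)"
  shows "\<phi> \<in> presheaf_hom K L"
  using assms by (auto simp: presheaf_hom_def compose_def intro!: restrict_ext)

lemma presheaf_homD:
  assumes "\<phi> \<in> presheaf_hom K L"
  shows "\<phi> n \<in> obj K n \<rightarrow>\<^sub>E obj L n"
    and "x \<in> obj K n \<Longrightarrow> \<phi> n x \<in> obj L n"
    and "box m n f \<Longrightarrow> x \<in> obj K n \<Longrightarrow> \<phi> m (act K m n f x) = act L m n f (\<phi> n x)"
proof -
  show *: "\<phi> n \<in> obj K n \<rightarrow>\<^sub>E obj L n" using assms by (simp add: presheaf_hom_def)
  show "x \<in> obj K n \<Longrightarrow> \<phi> n x \<in> obj L n" using * by blast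
  assume "box m n f" and x: "x \<in> obj K n"
  then have "compose (obj K n) (\<phi> m) (act K m n f) x = compose (obj K n) (act L m n f) (\<phi> n) x"
    using assms by (simp add: presheaf_hom_def)
  then show "\<phi> m (act K m n f x) = act L m n f (\<phi> n x)" using x by (simp add: compose_eq)
qed

lemma bangS_map_hom:
  assumes "h ` A \<subseteq> B"
  shows "bangS_map A h \<in> presheaf_hom (bangS A) (bangS B)"
proof (rule presheaf_homI)
  show words: "bangS_map A h n \<in> obj (bangS A) n \<rightarrow>\<^sub>E obj (bangS B) n" for n
    using assms by (fastforce simp: bangS_map_def words_def)
  fix m n f w assume f: "box m n f" and w: "w \<in> obj (bangS A) n"
  have "act (bangS A) m n f w \<in> words A m"
    using bangS_presheaf[of A] f w by (auto simp: symmetric_precubical_set_def)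
  moreover have "map h w \<in> words B n" using w assms by (auto simp: words_def)
  ultimately show "bangS_map A h m (act (bangS A) m n f w)
      = act (bangS B) m n f (bangS_map A h n w)"
    using w box_slot(1)[OF f] by (auto simp: bangS_map_def bangS_act words_def)
qed

lemma presheaf_actD:
  assumes "symmetric_precubical_set K"
  shows "box m n f \<Longrightarrow> act K m n f \<in> obj K n \<rightarrow>\<^sub>E obj K m"
    and "box m n f \<Longrightarrow> x \<in> obj K n \<Longrightarrow> act K m n f x \<in> obj K m"
    and "x \<in> obj K n \<Longrightarrow> act K n n (\<lambda>x\<in>cube n. x) x = x"
    and "box l m f \<Longrightarrow> box m n g \<Longrightarrow> x \<in> obj K n \<Longrightarrow>
           act K l n (compose (cube l) g f) x = act K l m f (act K m n g x)"
  using assms by (auto simp: symmetric_precubical_set_def compose_eq)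

lemma presheafI:
  assumes "\<And>m n f. box m n f \<Longrightarrow> act K m n f \<in> obj K n \<rightarrow>\<^sub>E obj K m"
    and "\<And>n x. x \<in> obj K n \<Longrightarrow> act K n n (\<lambda>x\<in>cube n. x) x = x"
    and "\<And>l m n f g x. box l m f \<Longrightarrow> box m n g \<Longrightarrow> x \<in> obj K n \<Longrightarrow>
           act K l n (compose (cube l) g f) x = act K l m f (act K m n g x)"
  shows "symmetric_precubical_set K"
  unfolding symmetric_precubical_set_def
proof (intro conjI allI impI)
  show "act K m n f \<in> obj K n \<rightarrow>\<^sub>E obj K m" if "box m n f" for m n f
    using assms(1) that .
  show "act K n n (\<lambda>x\<in>cube n. x) = (\<lambda>x\<in>obj K n. x)" for n
    by (rule extensionalityI[of _ "obj K n"])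
      (use assms(1)[OF box_id[of n]] in \<open>auto simp: assms(2) PiE_iff\<close>)
  show "act K l n (compose (cube l) g f) = compose (obj K n) (act K l m f) (act K m n g)"
    if "box l m f" "box m n g" for l m n f g
    by (rule extensionalityI[of _ "obj K n"])
      (use assms(1)[OF box_comp[OF that]] in \<open>auto simp: assms(3)[OF that] compose_eq PiE_iff\<close>)
qed

lemma P_objD:
  assumes "P_obj \<Sigma> X"
  shows "symmetric_precubical_set (tot X)" and "lab X \<in> presheaf_hom (tot X) (bangS \<Sigma>)"
  using assms by (simp_all add: P_obj_def)

lemma P_homI:
  assumes "P_obj \<Sigma> X" "P_obj \<Sigma> Y" "\<phi> \<in> presheaf_hom (tot X) (tot Y)"
    and "\<And>n x. x \<in> cells X n \<Longrightarrow> lab Y n (\<phi> n x) = lab X n x"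
  shows "P_hom \<Sigma> X Y \<phi>"
proof -
  have "comp_map X (lab Y) \<phi> n = lab X n" for n
    using presheaf_homD(1)[OF P_objD(2)[OF assms(1)], of n] assms(4)
    by (intro extensionalityI[of _ "cells X n"]) (auto simp: comp_map_def compose_eq PiE_iff)
  then show ?thesis using assms by (auto simp: P_hom_def)
qed

lemma P_homD:
  assumes "P_hom \<Sigma> X Y \<phi>"
  shows "P_obj \<Sigma> X" "P_obj \<Sigma> Y" "\<phi> \<in> presheaf_hom (tot X) (tot Y)"
    and "\<phi> n \<in> cells X n \<rightarrow>\<^sub>E cells Y n"
    and "x \<in> cells X n \<Longrightarrow> \<phi> n x \<in> cells Y n"
    and "x \<in> cells X n \<Longrightarrow> lab Y n (\<phi> n x) = lab X n x"
    and "box m n f \<Longrightarrow> x \<in> cells X n \<Longrightarrow>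
           \<phi> m (act (tot X) m n f x) = act (tot Y) m n f (\<phi> n x)"
proof -
  show *: "P_obj \<Sigma> X" "P_obj \<Sigma> Y" "\<phi> \<in> presheaf_hom (tot X) (tot Y)"
    using assms by (simp_all add: P_hom_def)
  show "\<phi> n \<in> cells X n \<rightarrow>\<^sub>E cells Y n" "x \<in> cells X n \<Longrightarrow> \<phi> n x \<in> cells Y n"
    "box m n f \<Longrightarrow> x \<in> cells X n \<Longrightarrow> \<phi> m (act (tot X) m n f x) = act (tot Y) m n f (\<phi> n x)"
    using presheaf_homD[OF *(3)] by auto
  have "comp_map X (lab Y) \<phi> n x = lab X n x" using assms by (simp add: P_hom_def)
  then show "x \<in> cells X n \<Longrightarrow> lab Y n (\<phi> n x) = lab X n x"
    by (simp add: comp_map_def compose_eq)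
qed

lemma P_hom_eqI:
  assumes "P_hom \<Sigma> X Y \<phi>" "P_hom \<Sigma> X Y \<psi>" "\<And>n x. x \<in> cells X n \<Longrightarrow> \<phi> n x = \<psi> n x"
  shows "\<phi> = \<psi>"
proof
  fix n show "\<phi> n = \<psi> n"
    using P_homD(4)[OF assms(1), of n] P_homD(4)[OF assms(2), of n] assms(3)
    by (intro extensionalityI[of _ "cells X n"]) (auto simp: PiE_iff)
qed

lemma P_hom_id: "P_obj \<Sigma> X \<Longrightarrow> P_hom \<Sigma> X X (id_map X)"
  by (intro P_homI presheaf_homI)
    (auto simp: id_map_def dest: P_objD(1) presheaf_actD(2))

lemma P_hom_comp:
  assumes "P_hom \<Sigma> X Y \<phi>" "P_hom \<Sigma> Y Z \<psi>"
  shows "P_hom \<Sigma> X Z (comp_map X \<psi> \<phi>)"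
proof (intro P_homI presheaf_homI)
  note \<phi> = P_homD[OF assms(1)] and \<psi> = P_homD[OF assms(2)]
  show "P_obj \<Sigma> X" "P_obj \<Sigma> Z" using \<phi> \<psi> by auto
  show "comp_map X \<psi> \<phi> n \<in> cells X n \<rightarrow>\<^sub>E cells Z n" for n
    using \<phi>(5) \<psi>(5) by (auto simp: comp_map_def compose_def)
  show "comp_map X \<psi> \<phi> m (act (tot X) m n f x) = act (tot Z) m n f (comp_map X \<psi> \<phi> n x)"
    if "box m n f" "x \<in> cells X n" for m n f x
    using that \<phi>(5,7) \<psi>(5,7) presheaf_actD(2)[OF P_objD(1)[OF \<phi>(1)] that]
    by (simp add: comp_map_def compose_eq)
  show "lab Z n (comp_map X \<psi> \<phi> n x) = lab X n x" if "x \<in> cells X n" for n x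
    using that \<phi>(5,6) \<psi>(6) by (simp add: comp_map_def compose_eq)
qed

lemma terminal_sel [simp]:
  "tot (terminal \<Sigma>) = bangS \<Sigma>" "lab (terminal \<Sigma>) n = (\<lambda>w\<in>words \<Sigma> n. w)"
  by (simp_all add: terminal_def)

lemma P_obj_terminal: "P_obj \<Sigma> (terminal \<Sigma>)"
  unfolding P_obj_def
proof
  show "symmetric_precubical_set (tot (terminal \<Sigma>))" by (simp add: bangS_presheaf)
  show "lab (terminal \<Sigma>) \<in> presheaf_hom (tot (terminal \<Sigma>)) (bangS \<Sigma>)"
    using presheaf_actD(2)[OF bangS_presheaf[of \<Sigma>]] by (intro presheaf_homI) auto
qed

lemma terminal_universal:
  assumes "P_obj \<Sigma> X"
  shows "P_hom \<Sigma> X (terminal \<Sigma>) \<phi> \<longleftrightarrow> \<phi> = lab X"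
proof -
  have *: "P_hom \<Sigma> X (terminal \<Sigma>) (lab X)"
    using assms P_obj_terminal P_objD[OF assms] presheaf_homD(2)[OF P_objD(2)[OF assms]]
    by (intro P_homI) auto
  moreover have "\<phi> = lab X" if "P_hom \<Sigma> X (terminal \<Sigma>) \<phi>"
    using P_homD(5,6)[OF that] by (intro P_hom_eqI[OF that *]) auto
  ultimately show ?thesis by auto
qed

lemma P_obj_interval: "P_obj \<Sigma> (interval \<Sigma>)"
  by (auto simp: P_obj_def interval_def bangS_presheaf intro!: bangS_map_hom)

lemma coprod_sel [simp]:
  "cells (coprod X Y) n = cells X n <+> cells Y n"
  "x \<in> cells X n \<Longrightarrow> act (tot (coprod X Y)) m n f (Inl x) = Inl (act (tot X) m n f x)"
  "y \<in> cells Y n \<Longrightarrow> act (tot (coprod X Y)) m n f (Inr y) = Inr (act (tot Y) m n f y)"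
  "x \<in> cells X n \<Longrightarrow> lab (coprod X Y) n (Inl x) = lab X n x"
  "y \<in> cells Y n \<Longrightarrow> lab (coprod X Y) n (Inr y) = lab Y n y"
  by (simp_all add: coprod_def InlI InrI)

lemma P_obj_coprod:
  assumes "P_obj \<Sigma> X" "P_obj \<Sigma> Y"
  shows "P_obj \<Sigma> (coprod X Y)"
  unfolding P_obj_def
proof
  note X = P_objD[OF assms(1)] and Y = P_objD[OF assms(2)]
  note a = presheaf_actD[OF X(1)] presheaf_actD[OF Y(1)]
  note h = presheaf_homD[OF X(2)] presheaf_homD[OF Y(2)]
  have "act (tot (coprod X Y)) m n f \<in> extensional (cells (coprod X Y) n)" for m n f
    by (simp add: coprod_def)
  then show "symmetric_precubical_set (tot (coprod X Y))"
    by (intro presheafI) (auto simp: PiE_iff a)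
  have "lab (coprod X Y) n \<in> extensional (cells (coprod X Y) n)" for n
    by (simp add: coprod_def)
  then show "lab (coprod X Y) \<in> presheaf_hom (tot (coprod X Y)) (bangS \<Sigma>)"
    using h(2,5) by (intro presheaf_homI) (auto simp: PiE_iff a h)
qed

lemma coprod_universal:
  assumes "P_hom \<Sigma> X Z \<phi>" "P_hom \<Sigma> Y Z \<psi>"
  shows "P_hom \<Sigma> X (coprod X Y) (in_left X)" "P_hom \<Sigma> Y (coprod X Y) (in_right Y)"
    and "P_hom \<Sigma> (coprod X Y) Z \<chi> \<and> comp_map X \<chi> (in_left X) = \<phi> \<and> comp_map Y \<chi> (in_right Y) = \<psi>
           \<longleftrightarrow> \<chi> = copair X Y \<phi> \<psi>"
proof -
  note \<phi> = P_homD[OF assms(1)] and \<psi> = P_homD[OF assms(2)]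
  note C = P_obj_coprod[OF \<phi>(1) \<psi>(1)]
  note a = presheaf_actD[OF P_objD(1)[OF \<phi>(1)]] presheaf_actD[OF P_objD(1)[OF \<psi>(1)]]
  show inl: "P_hom \<Sigma> X (coprod X Y) (in_left X)"
    using \<phi>(1) C by (intro P_homI presheaf_homI) (auto simp: in_left_def a)
  show inr: "P_hom \<Sigma> Y (coprod X Y) (in_right Y)"
    using \<psi>(1) C by (intro P_homI presheaf_homI) (auto simp: in_right_def a)
  have *: "P_hom \<Sigma> (coprod X Y) Z (copair X Y \<phi> \<psi>)"
    using \<phi>(2) C by (intro P_homI presheaf_homI) (auto simp: copair_def InlI InrI \<phi>(5-7) \<psi>(5-7) a)
  have **: "comp_map X (copair X Y \<phi> \<psi>) (in_left X) = \<phi>"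
    by (rule P_hom_eqI[OF P_hom_comp[OF inl *] assms(1)])
      (auto simp: comp_map_def compose_eq in_left_def copair_def InlI)
  have ***: "comp_map Y (copair X Y \<phi> \<psi>) (in_right Y) = \<psi>"
    by (rule P_hom_eqI[OF P_hom_comp[OF inr *] assms(2)])
      (auto simp: comp_map_def compose_eq in_right_def copair_def InrI)
  have "\<chi> = copair X Y \<phi> \<psi>"
    if "P_hom \<Sigma> (coprod X Y) Z \<chi>" "comp_map X \<chi> (in_left X) = \<phi>" "comp_map Y \<chi> (in_right Y) = \<psi>"
    by (rule P_hom_eqI[OF that(1) *])
      (auto simp: copair_def InlI InrI comp_map_def compose_eq in_left_def in_right_def
        that(2,3)[symmetric])
  then show "P_hom \<Sigma> (coprod X Y) Z \<chi> \<and> comp_map X \<chi> (in_left X) = \<phi> \<and>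
      comp_map Y \<chi> (in_right Y) = \<psi> \<longleftrightarrow> \<chi> = copair X Y \<phi> \<psi>"
    using * ** *** by auto
qed

lemma fprod_sel [simp]:
  "(x, y) \<in> cells (fprod X Y) n \<longleftrightarrow> x \<in> cells X n \<and> y \<in> cells Y n \<and> lab X n x = lab Y n y"
  "(x, y) \<in> cells (fprod X Y) n \<Longrightarrow>
     act (tot (fprod X Y)) m n f (x, y) = (act (tot X) m n f x, act (tot Y) m n f y)"
  "(x, y) \<in> cells (fprod X Y) n \<Longrightarrow> lab (fprod X Y) n (x, y) = lab X n x"
  by (auto simp: fprod_def Let_def)

lemma P_obj_fprod:
  assumes "P_obj \<Sigma> X" "P_obj \<Sigma> Y"
  shows "P_obj \<Sigma> (fprod X Y)"
  unfolding P_obj_def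
proof
  note X = P_objD[OF assms(1)] and Y = P_objD[OF assms(2)]
  note a = presheaf_actD[OF X(1)] presheaf_actD[OF Y(1)]
  note h = presheaf_homD[OF X(2)] presheaf_homD[OF Y(2)]
  have "act (tot (fprod X Y)) m n f \<in> extensional (cells (fprod X Y) n)" for m n f
    by (simp add: fprod_def Let_def)
  then show "symmetric_precubical_set (tot (fprod X Y))"
    by (intro presheafI) (auto simp: PiE_iff a h)
  have "lab (fprod X Y) n \<in> extensional (cells (fprod X Y) n)" for n
    by (simp add: fprod_def Let_def)
  then show "lab (fprod X Y) \<in> presheaf_hom (tot (fprod X Y)) (bangS \<Sigma>)"
    using h(2,5) by (intro presheaf_homI) (auto simp: PiE_iff a h)
qed

lemma fprod_universal:
  assumes "P_hom \<Sigma> Z X \<phi>" "P_hom \<Sigma> Z Y \<psi>"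
  shows "P_hom \<Sigma> (fprod X Y) X (proj_left X Y)" "P_hom \<Sigma> (fprod X Y) Y (proj_right X Y)"
    and "P_hom \<Sigma> Z (fprod X Y) \<chi> \<and> comp_map Z (proj_left X Y) \<chi> = \<phi> \<and>
           comp_map Z (proj_right X Y) \<chi> = \<psi> \<longleftrightarrow> \<chi> = pairing Z \<phi> \<psi>"
proof -
  note \<phi> = P_homD[OF assms(1)] and \<psi> = P_homD[OF assms(2)]
  note C = P_obj_fprod[OF \<phi>(2) \<psi>(2)]
  note a = presheaf_actD[OF P_objD(1)[OF \<phi>(2)]] presheaf_actD[OF P_objD(1)[OF \<psi>(2)]]
    presheaf_actD[OF P_objD(1)[OF \<phi>(1)]] presheaf_actD[OF P_objD(1)[OF C]]
  note h = presheaf_homD[OF P_objD(2)[OF \<phi>(2)]] presheaf_homD[OF P_objD(2)[OF \<psi>(2)]]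
  show pl: "P_hom \<Sigma> (fprod X Y) X (proj_left X Y)"
    using \<phi>(2) C by (intro P_homI presheaf_homI) (auto simp: proj_left_def a h)
  show pr: "P_hom \<Sigma> (fprod X Y) Y (proj_right X Y)"
    using \<psi>(2) C by (intro P_homI presheaf_homI) (auto simp: proj_right_def a h)
  have *: "P_hom \<Sigma> Z (fprod X Y) (pairing Z \<phi> \<psi>)"
    using \<phi>(1) C by (intro P_homI presheaf_homI) (auto simp: pairing_def \<phi>(5-7) \<psi>(5-7) a)
  have **: "comp_map Z (proj_left X Y) (pairing Z \<phi> \<psi>) = \<phi>"
    by (rule P_hom_eqI[OF P_hom_comp[OF * pl] assms(1)])
      (auto simp: comp_map_def compose_eq proj_left_def pairing_def \<phi>(5,6) \<psi>(5,6))
  have ***: "comp_map Z (proj_right X Y) (pairing Z \<phi> \<psi>) = \<psi>"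
    by (rule P_hom_eqI[OF P_hom_comp[OF * pr] assms(2)])
      (auto simp: comp_map_def compose_eq proj_right_def pairing_def \<phi>(5,6) \<psi>(5,6))
  have "\<chi> = pairing Z \<phi> \<psi>"
    if "P_hom \<Sigma> Z (fprod X Y) \<chi>" "comp_map Z (proj_left X Y) \<chi> = \<phi>"
      "comp_map Z (proj_right X Y) \<chi> = \<psi>"
    using P_homD(5)[OF that(1)]
    by (intro P_hom_eqI[OF that(1) *])
      (auto simp: pairing_def comp_map_def compose_eq proj_left_def proj_right_def
        that(2,3)[symmetric])
  then show "P_hom \<Sigma> Z (fprod X Y) \<chi> \<and> comp_map Z (proj_left X Y) \<chi> = \<phi> \<and>
      comp_map Z (proj_right X Y) \<chi> = \<psi> \<longleftrightarrow> \<chi> = pairing Z \<phi> \<psi>"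
    using * ** *** by auto
qed

lemma two_copies_iso:
  assumes "P_obj \<Sigma> X"
  shows "P_hom \<Sigma> (coprod X X) (fprod (coprod (terminal \<Sigma>) (terminal \<Sigma>)) X) (two_copies \<Sigma> X)"
    and "bij_betw (two_copies \<Sigma> X n) (cells (coprod X X) n)
           (cells (fprod (coprod (terminal \<Sigma>) (terminal \<Sigma>)) X) n)"
proof -
  have l: "P_hom \<Sigma> X (terminal \<Sigma>) (lab X)" using terminal_universal[OF assms] by blast
  note t = P_hom_id[OF P_obj_terminal[of \<Sigma>]]
  note i = P_hom_comp[OF l coprod_universal(1)[OF t t]] P_hom_comp[OF l coprod_universal(2)[OF t t]]
  show "P_hom \<Sigma> (coprod X X) (fprod (coprod (terminal \<Sigma>) (terminal \<Sigma>)) X) (two_copies \<Sigma> X)"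
    unfolding two_copies_def
    using coprod_universal(3) fprod_universal(3) i P_hom_id[OF assms] by metis
  note w = presheaf_homD(2)[OF P_objD(2)[OF assms], simplified]
  show "bij_betw (two_copies \<Sigma> X n) (cells (coprod X X) n)
      (cells (fprod (coprod (terminal \<Sigma>) (terminal \<Sigma>)) X) n)"
    by (rule bij_betw_byWitness[where f' = "\<lambda>(c, x). case_sum (\<lambda>_. Inl x) (\<lambda>_. Inr x) c"])
      (auto simp: two_copies_def copair_def pairing_def id_map_def comp_map_def compose_eq
        in_left_def in_right_def InlI InrI w)
qed

end

theory Submission
  imports Defs
begin

text \<open>
  The cylinder on \<open>X\<close> consists of the cells of \<open>X\<close> together with a tag in \<open>{0,1}\<close> on every letter of
  the label, and \<open>\<gamma>\<^sup>k\<^sub>X\<close> tags all letters of a cell with \<open>k\<close>.  The cell is recovered as second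
  component, and as soon as \<open>n \<ge> 1\<close> the label of an \<open>n\<close>-cell has a letter from which the tag can be
  read off, so that \<open>\<gamma>\<^sup>0\<^sub>X \<squnion> \<gamma>\<^sup>1\<^sub>X\<close> is injective on \<open>n\<close>-cells.
\<close>

lemma P_hom_copair:
  assumes "P_hom \<Sigma> X Z \<phi>" "P_hom \<Sigma> Y Z \<psi>"
  shows "P_hom \<Sigma> (coprod X Y) Z (copair X Y \<phi> \<psi>)"
  using coprod_universal(3)[OF assms] by blast

lemma P_hom_pairing:
  assumes "P_hom \<Sigma> Z X \<phi>" "P_hom \<Sigma> Z Y \<psi>"
  shows "P_hom \<Sigma> Z (fprod X Y) (pairing Z \<phi> \<psi>)"
  using fprod_universal(3)[OF assms] by blast

text \<open>Direct check on cells: \<open>fprod_universal\<close> yields the projections only when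
  some \<open>Z\<close> maps to both factors, whereas here only the factors are given.\<close>

lemma P_hom_proj:
  assumes "P_obj \<Sigma> X" "P_obj \<Sigma> Y"
  shows "P_hom \<Sigma> (fprod X Y) X (proj_left X Y)" "P_hom \<Sigma> (fprod X Y) Y (proj_right X Y)"
proof -
  note C = P_obj_fprod[OF assms]
  note a = presheaf_actD(2)[OF P_objD(1)[OF C]]
  show "P_hom \<Sigma> (fprod X Y) X (proj_left X Y)" "P_hom \<Sigma> (fprod X Y) Y (proj_right X Y)"
    using assms C a by (auto intro!: P_homI presheaf_homI simp: proj_left_def proj_right_def)
qed

lemma P_hom_prod_map:
  assumes "P_hom \<Sigma> X X' \<phi>" "P_hom \<Sigma> Y Y' \<psi>"
  shows "P_hom \<Sigma> (fprod X Y) (fprod X' Y') (prod_map X Y \<phi> \<psi>)"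
  unfolding prod_map_def
  using P_hom_proj[OF P_homD(1)[OF assms(1)] P_homD(1)[OF assms(2)]] assms
  by (intro P_hom_pairing P_hom_comp)

lemma comp_map_apply: "x \<in> cells X n \<Longrightarrow> comp_map X \<psi> \<phi> n x = \<psi> n (\<phi> n x)"
  by (simp add: comp_map_def compose_eq)

lemma id_map_apply: "x \<in> cells X n \<Longrightarrow> id_map X n x = x"
  by (simp add: id_map_def)

lemma prod_map_apply:
  "(x, y) \<in> cells (fprod X Y) n \<Longrightarrow> prod_map X Y \<phi> \<psi> n (x, y) = (\<phi> n x, \<psi> n y)"
  \<comment> \<open>With \<open>fprod_sel(1)\<close> deleted, membership of the pair is not split
    and matches the premise of \<open>comp_map_apply\<close> as it stands.\<close>
  by (simp add: prod_map_def pairing_def comp_map_apply proj_left_def proj_right_def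
      del: fprod_sel(1))

lemma copair_apply:
  "x \<in> cells X n \<Longrightarrow> copair X Y \<phi> \<psi> n (Inl x) = \<phi> n x"
  "y \<in> cells Y n \<Longrightarrow> copair X Y \<phi> \<psi> n (Inr y) = \<psi> n y"
  by (simp_all add: copair_def InlI InrI)

lemma interval_sel [simp]:
  "tot (interval \<Sigma>) = bangS (\<Sigma> \<times> UNIV)" "lab (interval \<Sigma>) = \<sigma> \<Sigma>"
  by (simp_all add: interval_def \<sigma>_def)

lemma \<gamma>_apply: "w \<in> words \<Sigma> n \<Longrightarrow> \<gamma> \<Sigma> k n w = map (\<lambda>a. (a, k)) w"
  by (simp add: \<gamma>_def bangS_map_def)

lemma \<sigma>_apply: "w \<in> words (\<Sigma> \<times> UNIV) n \<Longrightarrow> \<sigma> \<Sigma> n w = map fst w"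
  by (simp add: \<sigma>_def bangS_map_def)

lemma \<gamma>_words: "w \<in> words \<Sigma> n \<Longrightarrow> \<gamma> \<Sigma> k n w \<in> words (\<Sigma> \<times> UNIV) n"
  by (auto simp: \<gamma>_apply words_def)

lemma \<sigma>_\<gamma>: "w \<in> words \<Sigma> n \<Longrightarrow> \<sigma> \<Sigma> n (\<gamma> \<Sigma> k n w) = w"
  \<comment> \<open>Two passes: \<open>\<sigma>_apply\<close> is used while \<open>\<gamma>\<close>
    is still folded, so that \<open>\<gamma>_words\<close> settles its premise; only then is
    \<open>\<gamma>\<close> expanded.\<close>
  using \<gamma>_words[of w \<Sigma> n k] by (simp add: \<sigma>_apply) (simp add: \<gamma>_apply o_def)

text \<open>The labelling of the interval is \<open>\<sigma> \<Sigma>\<close>, so compatibility with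
  labels amounts to \<open>\<sigma>_\<gamma>\<close>.\<close>

lemma P_hom_\<gamma>: "P_hom \<Sigma> (terminal \<Sigma>) (interval \<Sigma>) (\<gamma> \<Sigma> k)"
  by (intro P_homI P_obj_terminal P_obj_interval)
    (auto simp: \<gamma>_def \<sigma>_\<gamma>[unfolded \<gamma>_def] intro!: bangS_map_hom)

text \<open>A map to the terminal object is the labelling of its source, and
  \<open>interval \<Sigma>\<close> is labelled by \<open>\<sigma> \<Sigma>\<close>.\<close>

lemma P_hom_\<sigma>: "P_hom \<Sigma> (interval \<Sigma>) (terminal \<Sigma>) (\<sigma> \<Sigma>)"
  using terminal_universal[OF P_obj_interval, of \<Sigma> "\<sigma> \<Sigma>"] by simp

lemma P_hom_\<gamma>_sum:
  "P_hom \<Sigma> (coprod (terminal \<Sigma>) (terminal \<Sigma>)) (interval \<Sigma>) (\<gamma>_sum \<Sigma>)"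
  unfolding \<gamma>_sum_def by (intro P_hom_copair P_hom_\<gamma>)

lemma comp_map_\<sigma>_\<gamma>_sum:
  "comp_map (coprod (terminal \<Sigma>) (terminal \<Sigma>)) (\<sigma> \<Sigma>) (\<gamma>_sum \<Sigma>) = codiagonal (terminal \<Sigma>)"
proof (rule P_hom_eqI)
  show "P_hom \<Sigma> (coprod (terminal \<Sigma>) (terminal \<Sigma>)) (terminal \<Sigma>)
      (comp_map (coprod (terminal \<Sigma>) (terminal \<Sigma>)) (\<sigma> \<Sigma>) (\<gamma>_sum \<Sigma>))"
    by (rule P_hom_comp[OF P_hom_\<gamma>_sum P_hom_\<sigma>])
  show "P_hom \<Sigma> (coprod (terminal \<Sigma>) (terminal \<Sigma>)) (terminal \<Sigma>) (codiagonal (terminal \<Sigma>))"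
    unfolding codiagonal_def by (intro P_hom_copair P_hom_id P_obj_terminal)
qed (auto simp: comp_map_apply \<gamma>_sum_def codiagonal_def copair_apply id_map_apply \<sigma>_\<gamma> InlI InrI)

context
  fixes \<Sigma> :: "'l set" and X :: "('a, 'l) labelled"
  assumes X: "P_obj \<Sigma> X"
begin

lemma lab_words: "x \<in> cells X n \<Longrightarrow> lab X n x \<in> words \<Sigma> n"
  using presheaf_homD(2)[OF P_objD(2)[OF X]] by simp

lemma P_hom_lab: "P_hom \<Sigma> X (terminal \<Sigma>) (lab X)"
  using terminal_universal[OF X] by blast

lemma P_hom_\<gamma>_cyl: "P_hom \<Sigma> X (Cyl \<Sigma> X) (\<gamma>_cyl \<Sigma> X k)"
  unfolding \<gamma>_cyl_def Cyl_def
  by (intro P_hom_comp[OF P_hom_pairing P_hom_prod_map] P_hom_lab P_hom_id X P_hom_\<gamma>)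

text \<open>The isomorphism of \<open>X\<close> with its product with
  \<open>terminal \<Sigma>\<close> sends \<open>x\<close> to \<open>(lab X n x, x)\<close>; then
  \<open>\<gamma>\<close> tags the first component.\<close>

lemma \<gamma>_cyl_apply: "x \<in> cells X n \<Longrightarrow> \<gamma>_cyl \<Sigma> X k n x = (\<gamma> \<Sigma> k n (lab X n x), x)"
  by (simp add: \<gamma>_cyl_def comp_map_apply pairing_def prod_map_apply id_map_apply lab_words)

lemma P_hom_\<gamma>_cyl_sum: "P_hom \<Sigma> (coprod X X) (Cyl \<Sigma> X) (\<gamma>_cyl_sum \<Sigma> X)"
  unfolding \<gamma>_cyl_sum_def by (intro P_hom_copair P_hom_\<gamma>_cyl)

lemma \<gamma>_cyl_sum_apply:
  assumes "x \<in> cells X n"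
  shows "\<gamma>_cyl_sum \<Sigma> X n (Inl x) = (\<gamma> \<Sigma> False n (lab X n x), x)"
    and "\<gamma>_cyl_sum \<Sigma> X n (Inr x) = (\<gamma> \<Sigma> True n (lab X n x), x)"
  using assms by (simp_all add: \<gamma>_cyl_sum_def copair_apply \<gamma>_cyl_apply)

lemma cofibration_\<gamma>_cyl_sum: "cofibration \<Sigma> (coprod X X) (Cyl \<Sigma> X) (\<gamma>_cyl_sum \<Sigma> X)"
  unfolding cofibration_def
proof (intro conjI allI impI)
  fix n :: nat assume n: "1 \<le> n"
  \<comment> \<open>The first letters already carry different tags; in degree 0 both words would be
    empty.\<close>
  have "\<gamma> \<Sigma> False n (lab X n x) \<noteq> \<gamma> \<Sigma> True n (lab X n x)" if "x \<in> cells X n" for x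
    using lab_words[OF that] n by (cases "lab X n x") (auto simp: \<gamma>_apply words_def)
  \<comment> \<open>A collision between the two copies can occur in either order, so the inequality
    is supplied in both orientations.\<close>
  note this this[symmetric]
  then show "inj_on (\<gamma>_cyl_sum \<Sigma> X n) (cells (coprod X X) n)"
    by (auto simp: inj_on_def \<gamma>_cyl_sum_apply)
qed (rule P_hom_\<gamma>_cyl_sum)

lemma P_hom_\<sigma>_cyl: "P_hom \<Sigma> (Cyl \<Sigma> X) X (\<sigma>_cyl \<Sigma> X)"
  unfolding \<sigma>_cyl_def Cyl_def
  by (intro P_hom_comp[OF P_hom_prod_map P_hom_proj(2)] P_hom_\<sigma> P_hom_id P_obj_terminal X)

lemma \<sigma>_cyl_apply:
  assumes "(w, x) \<in> cells (Cyl \<Sigma> X) n"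
  shows "\<sigma>_cyl \<Sigma> X n (w, x) = x"
proof -
  \<comment> \<open>Lying in the cylinder means \<open>\<sigma> \<Sigma> n w = lab X n x\<close>,
    which is also the fibre condition over \<open>terminal \<Sigma>\<close>.\<close>
  have "(\<sigma> \<Sigma> n w, x) \<in> cells (fprod (terminal \<Sigma>) X) n"
    using assms by (auto simp: Cyl_def lab_words)
  then show ?thesis
    using assms by (auto simp: \<sigma>_cyl_def Cyl_def comp_map_apply prod_map_apply proj_right_def
        id_map_apply)
qed

lemma comp_map_\<sigma>_cyl_\<gamma>_cyl_sum:
  "comp_map (coprod X X) (\<sigma>_cyl \<Sigma> X) (\<gamma>_cyl_sum \<Sigma> X) = codiagonal X"
proof (rule P_hom_eqI)
  show "P_hom \<Sigma> (coprod X X) X (comp_map (coprod X X) (\<sigma>_cyl \<Sigma> X) (\<gamma>_cyl_sum \<Sigma> X))"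
    by (rule P_hom_comp[OF P_hom_\<gamma>_cyl_sum P_hom_\<sigma>_cyl])
  show "P_hom \<Sigma> (coprod X X) X (codiagonal X)"
    unfolding codiagonal_def by (intro P_hom_copair P_hom_id X)
  \<comment> \<open>This is the premise of \<open>\<sigma>_cyl_apply\<close>; the fibre condition is
    \<open>\<sigma>_\<gamma>\<close>.\<close>
  have "(\<gamma> \<Sigma> k n (lab X n x), x) \<in> cells (Cyl \<Sigma> X) n" if "x \<in> cells X n" for k n x
    using that by (simp add: Cyl_def lab_words \<gamma>_words \<sigma>_\<gamma>)
  then show "comp_map (coprod X X) (\<sigma>_cyl \<Sigma> X) (\<gamma>_cyl_sum \<Sigma> X) n z = codiagonal X n z"
    if "z \<in> cells (coprod X X) n" for n z
    using that by (auto simp: comp_map_apply \<gamma>_cyl_sum_apply \<sigma>_cyl_apply codiagonal_def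
        copair_apply id_map_apply InlI InrI)
qed

text \<open>\<open>two_copies\<close> sends \<open>Inl x\<close> and \<open>Inr x\<close> to the
  label of \<open>x\<close> in the left or right copy of \<open>terminal \<Sigma>\<close>, paired
  with \<open>x\<close>; there \<open>\<gamma>_sum\<close> is \<open>\<gamma> \<Sigma> False\<close>
  or \<open>\<gamma> \<Sigma> True\<close>. Hence the cofibration property carries over to the
  induced map.\<close>

lemma induced_\<gamma>_sum: "induced \<Sigma> X (\<gamma>_sum \<Sigma>) = \<gamma>_cyl_sum \<Sigma> X"
proof (rule P_hom_eqI[OF _ P_hom_\<gamma>_cyl_sum])
  show "P_hom \<Sigma> (coprod X X) (Cyl \<Sigma> X) (induced \<Sigma> X (\<gamma>_sum \<Sigma>))"
    unfolding induced_def Cyl_def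
    by (intro P_hom_comp[OF two_copies_iso(1)] P_hom_prod_map P_hom_\<gamma>_sum P_hom_id X)
  show "induced \<Sigma> X (\<gamma>_sum \<Sigma>) n z = \<gamma>_cyl_sum \<Sigma> X n z" if "z \<in> cells (coprod X X) n" for n z
    using that by (auto simp: induced_def two_copies_def comp_map_apply copair_apply pairing_def
        in_left_def in_right_def id_map_apply prod_map_apply \<gamma>_cyl_sum_apply \<gamma>_sum_def
        lab_words InlI InrI)
qed

end

theorem proposition6p6:
  fixes \<Sigma> :: "'l set"
  assumes "\<Sigma> \<noteq> {}"
  shows "P_hom \<Sigma> (coprod (terminal \<Sigma>) (terminal \<Sigma>)) (interval \<Sigma>) (\<gamma>_sum \<Sigma>) \<and>
    P_hom \<Sigma> (interval \<Sigma>) (terminal \<Sigma>) (\<sigma> \<Sigma>) \<and>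
    comp_map (coprod (terminal \<Sigma>) (terminal \<Sigma>)) (\<sigma> \<Sigma>) (\<gamma>_sum \<Sigma>) = codiagonal (terminal \<Sigma>) \<and>
    (\<forall>X :: ('a, 'l) labelled. P_obj \<Sigma> X \<longrightarrow>
       cofibration \<Sigma> (coprod X X) (Cyl \<Sigma> X) (induced \<Sigma> X (\<gamma>_sum \<Sigma>))) \<and>
    good_interval \<Sigma> TYPE('a)"
  by (simp add: good_interval_def P_hom_\<gamma>_sum P_hom_\<sigma> comp_map_\<sigma>_\<gamma>_sum induced_\<gamma>_sum
      cofibration_\<gamma>_cyl_sum P_hom_\<sigma>_cyl comp_map_\<sigma>_cyl_\<gamma>_cyl_sum)

end
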